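(* Let $G$ be a locally compact group and let $\mathscr{A}_1(G)\subset \mathscr{A}_2(G)\subseteq \mathscr{LUC}(G)$ be two unital $C^*$-subalgebras of $\ell_\infty(G)$ with $\mathscr{A}_2(G)$ admissible. Let $\kappa$ be a cardinal and suppose that $G$ contains a family of subsets $\{T_\eta : \eta<\kappa\}$ such that: (i) $T_\eta\cap T_{\eta'}=\emptyset$ for every $\eta\neq\eta'<\kappa$; (ii) $T_\eta$ fails to be an $\mathscr{A}_1(G)$-interpolation set for every $\eta<\kappa$; (iii) $T=\bigcup_{\eta<\kappa}T_\eta$ is an approximable $\mathscr{A}_2(G)$-interpolation set. Suppose in addition that $U$ is a compact neighbourhood of the identity such that $T$ is right $U$-uniformly discrete. Then there is a linear isometry $\Psi\colon \ell_\infty(\kappa)\to \mathscr{A}_2(G)/\mathscr{A}_1(G)$.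
   Context: All topological groups are Hausdorff, with identity $e$. $\ell_\infty(X)$ denotes the bounded complex-valued functions on $X$ with the supremum norm. $\mathscr{LUC}(G)$ is the algebra of bounded functions $f$ on $G$ such that for every $\epsilon>0$ there is a neighbourhood $W$ of $e$ with $|f(s)-f(t)|<\epsilon$ whenever $st^{-1}\in W$. Admissibility: for a unital $C^*$-subalgebra $\mathscr{A}(G)\subseteq\ell_\infty(G)$ let $G^{\mathscr{A}}$ be its spectrum (non-zero multiplicative linear functionals, with the topology of pointwise convergence). Put $f_s(t)=f(st)$. $\mathscr{A}(G)$ is left translation invariant if $f_s\in\mathscr{A}(G)$ for all $f\in\mathscr{A}(G)$, $s\in G$; then for $x\in G^{\mathscr{A}}$ and $f\in\mathscr{A}(G)$ define $xf$ on $G$ by $xf(s)=x(f_s)$. $\mathscr{A}(G)$ is admissible if $1$, $f_s$ and $xf$ belong to $\mathscr{A}(G)$ for all $s\in G$, $x\in G^{\mathscr{A}}$, $f\in\mathscr{A}(G)$. Let $\mathscr{A}(G)\subseteq\ell_\infty(G)$. A set $T\subseteq G$ is an $\mathscr{A}(G)$-interpolation set if every bounded function $f\colon T\to\mathbb{C}$ extends to a function in $\mathscr{A}(G)$. It is an approximable $\mathscr{A}(G)$-interpolation set if it is an $\mathscr{A}(G)$-interpolation set and for every neighbourhood $W$ of $e$ there are open neighbourhoods $V_1,V_2$ of $e$ with $\overline{V_1}\subseteq V_2\subseteq W$ such that for each $T_1\subseteq T$ there is $h\in\mathscr{A}(G)$ with $h=1$ on $V_1T_1$ and $h=0$ on $G\setminus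 V_2T_1$. $T$ is right $U$-uniformly discrete if $Us\cap Us'=\emptyset$ for all distinct $s,s'\in T$. The quotient $\mathscr{A}_2(G)/\mathscr{A}_1(G)$ carries the quotient norm; a linear isometry need not be surjective. *)

theory Defs
  imports "HOL-Analysis.Analysis" "HOL-Library.Function_Algebras" "HOL-Library.Set_Algebras"
begin

text \<open>
  Groups are written additively, since the library's class of not necessarily commutative
  topological groups is \<^class>\<open>topological_group_add\<close>: the product \<open>s t\<close> is \<open>s + t\<close>, the quotient
  \<open>s t\<^sup>-\<^sup>1\<close> is \<open>s - t\<close>, the identity is \<open>0\<close>, and \<open>V T\<close> is the set sum \<open>V + T\<close>.
  A neighbourhood of the identity is a set with \<open>0\<close> in its interior.
\<close>

subsection \<open>Bounded functions\<close>

text \<open>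
  The elements of \<open>\<ell>\<^sub>\<infinity>(X)\<close> for a set \<open>X\<close> are the functions on the ambient type that are bounded on
  \<open>X\<close> and vanish off \<open>X\<close>.  Consequently the supremum norm can be taken over the whole
  (nonempty) type, which gives \<open>0\<close> when \<open>X\<close> is empty.
\<close>

definition linf :: "'x set \<Rightarrow> ('x \<Rightarrow> complex) set" where
  "linf X = {f. bounded (f ` X) \<and> (\<forall>x. x \<notin> X \<longrightarrow> f x = 0)}"

definition sup_norm :: "('x \<Rightarrow> complex) \<Rightarrow> real" where
  "sup_norm f = (SUP x. cmod (f x))"

definition cscale :: "complex \<Rightarrow> ('x \<Rightarrow> complex) \<Rightarrow> 'x \<Rightarrow> complex" where
  "cscale c f = (\<lambda>x. c * f x)"

definition unital_cstar_subalgebra :: "('x \<Rightarrow> complex) set \<Rightarrow> bool" where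
  "unital_cstar_subalgebra A \<longleftrightarrow>
     A \<subseteq> linf UNIV \<and> 1 \<in> A \<and>
     (\<forall>f\<in>A. \<forall>g\<in>A. f + g \<in> A \<and> f * g \<in> A) \<and>
     (\<forall>c. \<forall>f\<in>A. cscale c f \<in> A) \<and>
     (\<forall>f\<in>A. (\<lambda>x. cnj (f x)) \<in> A) \<and>
     (\<forall>F f. (\<forall>n. F n \<in> A) \<longrightarrow> uniform_limit UNIV F f sequentially \<longrightarrow> f \<in> A)"

subsection \<open>Function algebras on a topological group\<close>

definition LUC :: "('g::topological_group_add \<Rightarrow> complex) set" where
  "LUC = {f \<in> linf UNIV. \<forall>\<epsilon>>0. \<exists>W. 0 \<in> interior W \<and>
            (\<forall>s t. s - t \<in> W \<longrightarrow> cmod (f s - f t) < \<epsilon>)}"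

definition ltrans :: "'g::group_add \<Rightarrow> ('g \<Rightarrow> complex) \<Rightarrow> 'g \<Rightarrow> complex" where
  "ltrans s f = (\<lambda>t. f (s + t))"

text \<open>
  Functionals on \<open>A\<close> are total functions, normalised off \<open>A\<close> by membership in
  \<^term>\<open>extensional A\<close>.
\<close>

definition spectrum :: "('x \<Rightarrow> complex) set \<Rightarrow> (('x \<Rightarrow> complex) \<Rightarrow> complex) set" where
  "spectrum A = {\<phi> \<in> extensional A.
     (\<forall>f\<in>A. \<forall>g\<in>A. \<phi> (f + g) = \<phi> f + \<phi> g \<and> \<phi> (f * g) = \<phi> f * \<phi> g) \<and>
     (\<forall>c. \<forall>f\<in>A. \<phi> (cscale c f) = c * \<phi> f) \<and>
     (\<exists>f\<in>A. \<phi> f \<noteq> 0)}"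

definition left_translation_invariant :: "('g::group_add \<Rightarrow> complex) set \<Rightarrow> bool" where
  "left_translation_invariant A \<longleftrightarrow> (\<forall>f\<in>A. \<forall>s. ltrans s f \<in> A)"

definition admissible :: "('g::group_add \<Rightarrow> complex) set \<Rightarrow> bool" where
  "admissible A \<longleftrightarrow> 1 \<in> A \<and> left_translation_invariant A \<and>
     (\<forall>x\<in>spectrum A. \<forall>f\<in>A. (\<lambda>s. x (ltrans s f)) \<in> A)"

subsection \<open>Interpolation sets and uniform discreteness\<close>

definition interpolation_set :: "('x \<Rightarrow> complex) set \<Rightarrow> 'x set \<Rightarrow> bool" where
  "interpolation_set A T \<longleftrightarrow>
     (\<forall>f. bounded (f ` T) \<longrightarrow> (\<exists>g\<in>A. \<forall>t\<in>T. g t = f t))"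

definition approximable_interpolation_set ::
    "('g::topological_group_add \<Rightarrow> complex) set \<Rightarrow> 'g set \<Rightarrow> bool" where
  "approximable_interpolation_set A T \<longleftrightarrow> interpolation_set A T \<and>
     (\<forall>W. 0 \<in> interior W \<longrightarrow>
        (\<exists>V1 V2. open V1 \<and> open V2 \<and> 0 \<in> V1 \<and> 0 \<in> V2 \<and> closure V1 \<subseteq> V2 \<and> V2 \<subseteq> W \<and>
           (\<forall>T1\<subseteq>T. \<exists>h\<in>A. (\<forall>s\<in>V1 + T1. h s = 1) \<and> (\<forall>s\<in>UNIV - (V2 + T1). h s = 0))))"

definition right_uniformly_discrete :: "'g::group_add set \<Rightarrow> 'g set \<Rightarrow> bool" where
  "right_uniformly_discrete U T \<longleftrightarrow>
     (\<forall>s\<in>T. \<forall>s'\<in>T. s \<noteq> s' \<longrightarrow> (\<lambda>u. u + s) ` U \<inter> (\<lambda>u. u + s') ` U = {})"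

subsection \<open>Quotients by a subspace\<close>

text \<open>
  The quotient consists of the cosets \<open>f + B\<close>, which are added as sets.  In the scalar
  multiplication the summand \<open>B\<close> is needed for \<open>c = 0\<close>, so that \<open>0 (f + B) = B\<close>.
\<close>

definition quotient_space :: "('x \<Rightarrow> complex) set \<Rightarrow> ('x \<Rightarrow> complex) set \<Rightarrow> ('x \<Rightarrow> complex) set set" where
  "quotient_space A B = (\<lambda>f. f +o B) ` A"

definition quotient_scale ::
    "('x \<Rightarrow> complex) set \<Rightarrow> complex \<Rightarrow> ('x \<Rightarrow> complex) set \<Rightarrow> ('x \<Rightarrow> complex) set" where
  "quotient_scale B c C = cscale c ` C + B"

definition quotient_norm :: "('x \<Rightarrow> complex) set \<Rightarrow> real" where
  "quotient_norm C = (INF h\<in>C. sup_norm h)"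

definition linear_isometry_linf_quotient ::
    "'k set \<Rightarrow> ('x \<Rightarrow> complex) set \<Rightarrow> ('x \<Rightarrow> complex) set \<Rightarrow>
     (('k \<Rightarrow> complex) \<Rightarrow> ('x \<Rightarrow> complex) set) \<Rightarrow> bool" where
  "linear_isometry_linf_quotient K A B \<Psi> \<longleftrightarrow>
     (\<forall>f\<in>linf K. \<Psi> f \<in> quotient_space A B) \<and>
     (\<forall>f\<in>linf K. \<forall>g\<in>linf K. \<Psi> (f + g) = \<Psi> f + \<Psi> g) \<and>
     (\<forall>c. \<forall>f\<in>linf K. \<Psi> (cscale c f) = quotient_scale B c (\<Psi> f)) \<and>
     (\<forall>f\<in>linf K. quotient_norm (\<Psi> f) = sup_norm f)"

end

theory Submission
  imports Defs
begin

text \<open>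
  The isometry writes each \<open>f \<in> \<ell>\<^sub>\<infinity>(\<kappa>)\<close> on the sets \<open>T\<^sub>\<eta>\<close> as \<open>\<plusminus> f(\<eta>)\<close>, with a sign pattern
  that \<open>A\<^sub>1\<close> cannot see, and extends the result to the group by a bump function along \<open>T\<close>.

  \<^emph>\<open>Sign patterns.\<close>  If for every \<open>S \<subseteq> T\<^sub>\<eta>\<close> some function of \<open>A\<^sub>1\<close> were \<open>1\<close> on \<open>S\<close> and
  \<open>0\<close> on \<open>T\<^sub>\<eta> - S\<close>, then binary expansions would assemble every bounded function on \<open>T\<^sub>\<eta>\<close> from
  such functions (\<open>bounded_function_lift\<close>), and \<open>T\<^sub>\<eta>\<close> would be an \<open>A\<^sub>1\<close>-interpolation set.  So some
  \<open>S\<^sub>\<eta> \<subseteq> T\<^sub>\<eta>\<close> cannot be separated from its complement.  Let \<open>\<sigma>\<close> be \<open>1\<close> on \<open>S\<^sub>\<eta>\<close> and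
  \<open>-1\<close> on \<open>T\<^sub>\<eta> - S\<^sub>\<eta>\<close>.  A function \<open>g \<in> A\<^sub>1\<close> with \<open>\<bar>c \<sigma> + g\<bar> \<le> N < \<bar>c\<bar>\<close> on \<open>T\<^sub>\<eta>\<close> would take
  values in two half-planes with positive distance on the two pieces, and functional calculus
  would turn it into a separating function (\<open>separating_function\<close>).  Hence \<open>c \<sigma>\<close> has distance at
  least \<open>\<bar>c\<bar>\<close> from \<open>A\<^sub>1\<close>, already on \<open>T\<^sub>\<eta>\<close> (\<open>inseparable_lower_bound\<close>).

  \<^emph>\<open>Extension.\<close>  Approximability inside \<open>U\<close> gives a neighbourhood \<open>V\<close> of the identity such
  that every subset \<open>S\<close> of \<open>T\<close> has a function in \<open>A\<^sub>2\<close> that is \<open>1\<close> on \<open>V S\<close> and \<open>0\<close> on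
  \<open>V (T - S)\<close>.  By the same binary expansions, every bounded function on \<open>V T\<close> that is
  constant on each \<open>V t\<close> extends to \<open>A\<^sub>2\<close>.  Approximability inside \<open>V\<close> gives a bump
  \<open>u \<in> A\<^sub>2\<close> with \<open>\<bar>u\<bar> \<le> 1\<close>, \<open>u = 1\<close> on \<open>T\<close> and \<open>u = 0\<close> off \<open>V T\<close>.  Multiplying by \<open>u\<close> makes the
  extension independent of all choices, hence linear, without increasing the norm
  (\<open>bump_extension\<close>).
\<close>

section \<open>Functional calculus in a unital algebra of bounded functions\<close>

context
  fixes A :: "('x \<Rightarrow> complex) set"
  assumes A: "unital_cstar_subalgebra A"
begin

lemma cstar_add: "f \<in> A \<Longrightarrow> g \<in> A \<Longrightarrow> (\<lambda>x. f x + g x) \<in> A"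
  using A by (force simp: unital_cstar_subalgebra_def plus_fun_def)

lemma cstar_mult: "f \<in> A \<Longrightarrow> g \<in> A \<Longrightarrow> (\<lambda>x. f x * g x) \<in> A"
  using A by (force simp: unital_cstar_subalgebra_def times_fun_def)

lemma cstar_scale: "f \<in> A \<Longrightarrow> (\<lambda>x. c * f x) \<in> A"
  using A by (force simp: unital_cstar_subalgebra_def cscale_def)

lemma cstar_const: "(\<lambda>x. c) \<in> A"
proof -
  have "(1 :: 'x \<Rightarrow> complex) \<in> A"
    using A by (simp add: unital_cstar_subalgebra_def)
  from cstar_scale[OF this, of c] show ?thesis by simp
qed

lemma cstar_sum: "(\<And>i. i \<in> I \<Longrightarrow> F i \<in> A) \<Longrightarrow> (\<lambda>x. \<Sum>i\<in>I. F i x) \<in> A"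
  by (induction I rule: infinite_finite_induct) (auto intro: cstar_const cstar_add)

lemma cstar_uniform_limit:
  "(\<And>n. F n \<in> A) \<Longrightarrow> uniform_limit UNIV F f sequentially \<Longrightarrow> f \<in> A"
  using A by (force simp: unital_cstar_subalgebra_def)

lemma cstar_bounded:
  assumes "f \<in> A"
  shows "bounded (range f)"
  using A assms by (auto simp: unital_cstar_subalgebra_def linf_def)

lemma cstar_Re:
  assumes "f \<in> A"
  shows "(\<lambda>x. of_real (Re (f x))) \<in> A"
proof -
  have "(\<lambda>x. cnj (f x)) \<in> A"
    using A assms by (simp add: unital_cstar_subalgebra_def)
  from cstar_scale[OF cstar_add[OF assms this], of "1/2"]
  show ?thesis by (simp add: complex_add_cnj)
qed

lemma cstar_polynomial:
  assumes "real_polynomial_function q" "f \<in> A"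
  shows "(\<lambda>x. of_real (q (Re (f x)))) \<in> A"
  using assms(1)
proof induction
  case (linear q)
  then obtain a where "q = (\<lambda>r. r * a)"
    using real_bounded_linear by blast
  with cstar_scale[OF cstar_Re[OF assms(2)], of "of_real a"] show ?case
    by (simp add: mult.commute)
qed (auto intro: cstar_const dest: cstar_add cstar_mult)

text \<open>
  On the bounded range of \<open>Re f\<close>, the function \<open>q\<close> is a uniform limit of polynomials.
\<close>

lemma cstar_continuous_Re:
  assumes q: "continuous_on UNIV q" and f: "f \<in> A"
  shows "(\<lambda>x. of_real (q (Re (f x)))) \<in> A"
proof -
  obtain M where M: "\<And>x. cmod (f x) \<le> M"
    using cstar_bounded[OF f] by (auto simp: bounded_iff)
  have range: "Re (f x) \<in> {-M..M}" for x
    using abs_Re_le_cmod[of "f x"] M[of x] by auto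
  have "\<exists>p. real_polynomial_function p \<and> (\<forall>r\<in>{-M..M}. \<bar>q r - p r\<bar> < inverse (real (Suc n)))" for n
  proof -
    have "inverse (real (Suc n)) > 0" by simp
    with continuous_on_subset[OF q subset_UNIV, of "{-M..M}"]
    obtain p where "real_polynomial_function p"
      "\<And>r. r \<in> {-M..M} \<Longrightarrow> \<bar>q r - p r\<bar> < inverse (real (Suc n))"
      by (rule Stone_Weierstrass_real_polynomial_function[OF compact_Icc]) blast
    then show ?thesis by (intro exI conjI ballI)
  qed
  then obtain p where p: "\<And>n. real_polynomial_function (p n)"
    and approx: "\<And>n r. r \<in> {-M..M} \<Longrightarrow> \<bar>q r - p n r\<bar> < inverse (real (Suc n))"
    by metis
  have "uniform_limit UNIV (\<lambda>n x. complex_of_real (p n (Re (f x))))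
          (\<lambda>x. of_real (q (Re (f x)))) sequentially"
  proof (rule uniform_limitI)
    fix e :: real assume "e > 0"
    then have "\<forall>\<^sub>F n in sequentially. inverse (real (Suc n)) < e"
      using LIMSEQ_inverse_real_of_nat order_tendstoD(2) by blast
    then show "\<forall>\<^sub>F n in sequentially. \<forall>x\<in>UNIV.
        dist (complex_of_real (p n (Re (f x)))) (of_real (q (Re (f x)))) < e"
    proof eventually_elim
      case (elim n)
      show ?case
      proof
        fix x
        have "\<bar>q (Re (f x)) - p n (Re (f x))\<bar> < e"
          using approx[OF range, of x n] elim by linarith
        then show "dist (complex_of_real (p n (Re (f x)))) (of_real (q (Re (f x)))) < e"
          by (simp add: dist_norm abs_minus_commute flip: of_real_diff)
      qed
    qed
  qed
  then show ?thesis
    by (rule cstar_uniform_limit[rotated]) (rule cstar_polynomial[OF p f])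
qed

text \<open>
  The function is \<open>f\<close> followed by the real part, the affine map sending \<open>b\<close> to \<open>0\<close> and \<open>a\<close> to
  \<open>1\<close>, and truncation to the unit interval.
\<close>

lemma separating_function:
  assumes "f \<in> A" "b < a"
    and P: "\<And>x. x \<in> P \<Longrightarrow> a \<le> Re (f x)" and Q: "\<And>x. x \<in> Q \<Longrightarrow> Re (f x) \<le> b"
  obtains g where "g \<in> A" "\<And>x. x \<in> P \<Longrightarrow> g x = 1" "\<And>x. x \<in> Q \<Longrightarrow> g x = 0" "\<And>x. cmod (g x) \<le> 1"
proof
  define q where "q r = max 0 (min 1 ((r - b) / (a - b)))" for r
  have "continuous_on UNIV q"
    unfolding q_def using assms(2) by (intro continuous_intros) auto
  then show "(\<lambda>x. of_real (q (Re (f x)))) \<in> A"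
    using assms(1) by (rule cstar_continuous_Re)
  show "of_real (q (Re (f x))) = (1::complex)" if "x \<in> P" for x
    using P[OF that] assms(2) by (simp add: q_def)
  show "of_real (q (Re (f x))) = (0::complex)" if "x \<in> Q" for x
  proof -
    have "(Re (f x) - b) / (a - b) \<le> 0"
      using Q[OF that] assms(2) by (simp add: divide_le_0_iff)
    then show ?thesis by (simp add: q_def)
  qed
  show "cmod (of_real (q (Re (f x)))) \<le> 1" for x
    by (simp add: q_def)
qed

section \<open>Lifting bounded functions from indicator functions\<close>

lemma cstar_dyadic_series:
  assumes "\<And>n. F n \<in> A" "\<And>n x. cmod (F n x) \<le> 1"
  shows "(\<lambda>x. \<Sum>n. (1/2) ^ Suc n * F n x) \<in> A"
proof -
  have "uniform_limit UNIV (\<lambda>n x. \<Sum>i<n. (1/2) ^ Suc i * F i x)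
          (\<lambda>x. \<Sum>n. (1/2) ^ Suc n * F n x) sequentially"
  proof (rule Weierstrass_m_test)
    show "norm ((1/2) ^ Suc n * F n x) \<le> (1/2) ^ Suc n" for n x
      using mult_left_mono[OF assms(2)[of n x], of "(1/2) ^ Suc n"]
      by (simp add: norm_mult norm_power norm_divide)
    show "summable (\<lambda>n. (1/2 :: real) ^ Suc n)"
      using power_half_series sums_summable by blast
  qed
  then show ?thesis
    by (rule cstar_uniform_limit[rotated]) (intro cstar_sum cstar_scale assms)
qed

end

text \<open>
  The remainder \<open>bin_rem r n\<close> is \<open>2^n\<close> times the part of \<open>r\<close> that its first \<open>n\<close> binary digits
  leave over, each digit being \<open>1\<close> whenever it can be; this choice also expands \<open>r = 1\<close>, with all
  digits equal to \<open>1\<close>.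
\<close>

primrec bin_rem :: "real \<Rightarrow> nat \<Rightarrow> real" where
  "bin_rem r 0 = r"
| "bin_rem r (Suc n) = 2 * bin_rem r n - of_bool (bin_rem r n \<ge> 1/2)"

lemma bin_rem_bounds: "0 \<le> r \<Longrightarrow> r \<le> 1 \<Longrightarrow> 0 \<le> bin_rem r n \<and> bin_rem r n \<le> 1"
  by (induction n) auto

lemma bin_rem_partial:
  "(\<Sum>i<n. (1/2) ^ Suc i * of_bool (bin_rem r i \<ge> 1/2)) = r - (1/2) ^ n * bin_rem r n"
  by (induction n) (auto simp: field_simps)

lemma binary_expansion:
  assumes "0 \<le> r" "r \<le> 1"
  shows "(\<lambda>n. (1/2) ^ Suc n * of_bool (bin_rem r n \<ge> 1/2)) sums r"
proof -
  have "(\<lambda>n. (1/2) ^ n * bin_rem r n) \<longlonglongrightarrow> 0"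
  proof (rule Lim_null_comparison)
    show "\<forall>\<^sub>F n in sequentially. norm ((1/2) ^ n * bin_rem r n) \<le> (1/2) ^ n"
      using bin_rem_bounds[OF assms] by (simp add: abs_mult)
    show "(\<lambda>n. (1/2 :: real) ^ n) \<longlonglongrightarrow> 0"
      by (rule LIMSEQ_power_zero) simp
  qed
  from tendsto_diff[OF tendsto_const[of r] this] show ?thesis
    unfolding sums_def bin_rem_partial by simp
qed

text \<open>
  Only indicator functions of sets of the form \<open>p -` S\<close> need to be realised on \<open>D\<close>: the binary
  digits of a function \<open>f \<circ> p\<close> with values in the unit interval are such indicator functions, and
  the dyadic series of their realisations converges uniformly.  The general case follows by affine
  combinations.  The map \<open>p\<close> allows for functions constant on the members of a partition of \<open>D\<close>.
\<close>

lemma bounded_function_lift: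
  fixes A :: "('x \<Rightarrow> complex) set" and p :: "'x \<Rightarrow> 'y" and f :: "'y \<Rightarrow> complex"
  assumes A: "unital_cstar_subalgebra A"
    and ind: "\<And>S. \<exists>g\<in>A. (\<forall>x\<in>D. g x = of_bool (p x \<in> S)) \<and> (\<forall>x. cmod (g x) \<le> 1)"
    and f: "bounded (f ` p ` D)"
  obtains g where "g \<in> A" "\<And>x. x \<in> D \<Longrightarrow> g x = f (p x)"
proof -
  have unit: "\<exists>g\<in>A. \<forall>x\<in>D. g x = of_real (r (p x))"
    if r: "\<And>x. x \<in> D \<Longrightarrow> 0 \<le> r (p x) \<and> r (p x) \<le> 1" for r :: "'y \<Rightarrow> real"
  proof -
    obtain F where F: "\<And>n. F n \<in> A" "\<And>n x. cmod (F n x) \<le> 1"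
      and digit: "\<And>n x. x \<in> D \<Longrightarrow> F n x = of_bool (p x \<in> {y. bin_rem (r y) n \<ge> 1/2})"
      using ind[of "{y. bin_rem (r y) n \<ge> 1/2}" for n] by metis
    have "(\<Sum>n. (1/2) ^ Suc n * F n x) = of_real (r (p x))" if "x \<in> D" for x
    proof -
      have "(\<lambda>n. complex_of_real ((1/2) ^ Suc n * of_bool (bin_rem (r (p x)) n \<ge> 1/2)))
              sums of_real (r (p x))"
        using r[OF that] binary_expansion sums_of_real by blast
      moreover have "complex_of_real ((1/2) ^ Suc n * of_bool (bin_rem (r (p x)) n \<ge> 1/2)) =
          (1/2) ^ Suc n * F n x" for n
        using digit[OF that] by simp
      ultimately show ?thesis
        by (simp add: sums_iff)
    qed
    moreover have "(\<lambda>x. \<Sum>n. (1/2) ^ Suc n * F n x) \<in> A"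
      using F by (rule cstar_dyadic_series[OF A])
    ultimately show ?thesis by (intro bexI ballI)
  qed
  obtain M where M: "M > 0" "\<And>x. x \<in> D \<Longrightarrow> cmod (f (p x)) \<le> M"
    using f by (auto simp: bounded_pos)
  have real_case: "\<exists>g\<in>A. \<forall>x\<in>D. g x = of_real (r (p x))"
    if r: "\<And>x. x \<in> D \<Longrightarrow> \<bar>r (p x)\<bar> \<le> M" for r :: "'y \<Rightarrow> real"
  proof -
    have "0 \<le> (r (p x) / M + 1) / 2 \<and> (r (p x) / M + 1) / 2 \<le> 1" if "x \<in> D" for x
      using r[OF that] M(1) by (auto simp: field_simps abs_le_iff)
    from unit[where r = "\<lambda>y. (r y / M + 1) / 2", OF this]
    obtain g where g: "g \<in> A" "\<And>x. x \<in> D \<Longrightarrow> g x = of_real ((r (p x) / M + 1) / 2)"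
      by blast
    have "(\<lambda>x. of_real (2 * M) * g x + of_real (- M)) \<in> A"
      by (intro cstar_add[OF A] cstar_scale[OF A] cstar_const[OF A] g)
    moreover have "of_real (2 * M) * g x + of_real (- M) = of_real (r (p x))" if "x \<in> D" for x
      using g(2)[OF that] M(1) by (simp add: field_simps)
    ultimately show ?thesis by (intro bexI ballI)
  qed
  obtain a where a: "a \<in> A" "\<And>x. x \<in> D \<Longrightarrow> a x = of_real (Re (f (p x)))"
    using real_case[of "\<lambda>y. Re (f y)"] M(2) abs_Re_le_cmod order_trans by blast
  obtain b where b: "b \<in> A" "\<And>x. x \<in> D \<Longrightarrow> b x = of_real (Im (f (p x)))"
    using real_case[of "\<lambda>y. Im (f y)"] M(2) abs_Im_le_cmod order_trans by blast
  show thesis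
  proof
    show "(\<lambda>x. a x + \<i> * b x) \<in> A"
      by (intro cstar_add[OF A] cstar_scale[OF A] a b)
    show "a x + \<i> * b x = f (p x)" if "x \<in> D" for x
      using a(2)[OF that] b(2)[OF that] by (simp add: complex_eq_iff)
  qed
qed

section \<open>Sets that the smaller algebra cannot separate\<close>

text \<open>
  If every \<open>S\<close> could be separated from \<open>T - S\<close>, the indicator functions would be available for
  lifting all bounded functions on \<open>T\<close>.
\<close>

lemma inseparable_subset_exists:
  assumes A: "unital_cstar_subalgebra A" and "\<not> interpolation_set A T"
  obtains S where
    "\<not> (\<exists>g\<in>A. (\<forall>x\<in>T. g x = of_bool (x \<in> S)) \<and> (\<forall>x. cmod (g x) \<le> 1))"
proof (rule ccontr)
  assume "\<not> thesis"
  then have ind: "\<exists>g\<in>A. (\<forall>x\<in>T. g x = of_bool (x \<in> S)) \<and> (\<forall>x. cmod (g x) \<le> 1)" for S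
    using that by blast
  have "interpolation_set A T"
    unfolding interpolation_set_def
  proof (intro allI impI)
    fix f :: "'a \<Rightarrow> complex"
    assume "bounded (f ` T)"
    then show "\<exists>g\<in>A. \<forall>t\<in>T. g t = f t"
      using bounded_function_lift[where p = "\<lambda>x. x" and D = T and f = f and A = A] A ind
      by (metis image_ident)
  qed
  with assms(2) show False by blast
qed

text \<open>
  Rotate by \<open>cnj c / \<bar>c\<bar>\<close>: if \<open>N < \<bar>c\<bar>\<close>, the disc of radius \<open>N\<close> about \<open>c\<close> lies in the half-plane
  \<open>Re z \<ge> \<bar>c\<bar> - N\<close> and the disc about \<open>-c\<close> lies in \<open>Re z \<le> -(\<bar>c\<bar> - N)\<close>.  The values of \<open>-g\<close> on the
  two parts of \<open>T\<close> lie in these discs, so that \<open>g\<close> would yield a separating function.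
\<close>

lemma inseparable_lower_bound:
  assumes A: "unital_cstar_subalgebra A"
    and S: "\<not> (\<exists>g\<in>A. (\<forall>x\<in>T. g x = of_bool (x \<in> S)) \<and> (\<forall>x. cmod (g x) \<le> 1))"
    and g: "g \<in> A"
    and near: "\<And>x. x \<in> T \<Longrightarrow> cmod (c * (if x \<in> S then 1 else - 1) + g x) \<le> N"
  shows "cmod c \<le> N"
proof (rule ccontr)
  assume "\<not> cmod c \<le> N"
  then have N: "N < cmod c" by simp
  have "T \<noteq> {}"
    using S cstar_const[OF A, of 0] by fastforce
  then have "N \<ge> 0"
    using near norm_ge_zero order_trans by blast
  with N have c: "cmod c > 0" by linarith
  define w where "w = cnj c / of_real (cmod c)"
  have wc: "w * c = of_real (cmod c)"
    using c by (simp add: w_def mult.commute complex_norm_square[symmetric] power2_eq_square)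
  have w: "cmod w = 1"
    using c by (simp add: w_def norm_divide)
  have rotated: "\<bar>Re (w * (z + g x))\<bar> \<le> N" if "cmod (z + g x) \<le> N" for x z
    using abs_Re_le_cmod[of "w * (z + g x)"] that w by (simp add: norm_mult)
  have "cmod c - N \<le> Re (- w * g x)" if "x \<in> T \<inter> S" for x
    using rotated[of c x] near[of x] that wc by (simp add: ring_distribs)
  moreover have "Re (- w * g x) \<le> - (cmod c - N)" if "x \<in> T - S" for x
    using rotated[of "- c" x] near[of x] that wc by (simp add: ring_distribs)
  ultimately obtain h where "h \<in> A" "\<And>x. x \<in> T \<inter> S \<Longrightarrow> h x = 1"
    "\<And>x. x \<in> T - S \<Longrightarrow> h x = 0" "\<And>x. cmod (h x) \<le> 1"
    using separating_function[OF A cstar_scale[OF A g, of "- w"],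
        where b = "- (cmod c - N)" and a = "cmod c - N" and P = "T \<inter> S" and Q = "T - S"] N
    by auto
  then have "\<forall>x\<in>T. h x = of_bool (x \<in> S)"
    by auto
  with S \<open>h \<in> A\<close> \<open>\<And>x. cmod (h x) \<le> 1\<close> show False by blast
qed

section \<open>Extension from an approximable interpolation set\<close>

text \<open>
  The map \<open>p\<close> retracts \<open>V T\<close> onto \<open>T\<close>; it is well defined since the sets \<open>V t\<close> are disjoint.
  The same disjointness makes the functions that approximability gives for \<open>S \<subseteq> T\<close> vanish on
  \<open>V (T - S)\<close>, so that on \<open>V T\<close> they are indicator functions composed with \<open>p\<close>.  A second use of
  approximability, inside \<open>V\<close>, produces \<open>u\<close>.
\<close>

lemma bump_extension:
  fixes A :: "('g::topological_group_add \<Rightarrow> complex) set"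
  assumes A: "unital_cstar_subalgebra A"
    and T: "approximable_interpolation_set A T"
    and U: "0 \<in> interior U" "right_uniformly_discrete U T"
  obtains u :: "'g \<Rightarrow> complex" and p :: "'g \<Rightarrow> 'g"
  where "\<And>t. t \<in> T \<Longrightarrow> p t = t" "\<And>t. t \<in> T \<Longrightarrow> u t = 1" "\<And>s. cmod (u s) \<le> 1"
    "\<And>f. bounded (f ` T) \<Longrightarrow> (\<lambda>s. f (p s) * u s) \<in> A"
proof -
  have approx: "\<exists>V1 V2. open V1 \<and> open V2 \<and> 0 \<in> V1 \<and> 0 \<in> V2 \<and> closure V1 \<subseteq> V2 \<and> V2 \<subseteq> W \<and>
      (\<forall>T1\<subseteq>T. \<exists>h\<in>A. (\<forall>s\<in>V1 + T1. h s = 1) \<and> (\<forall>s\<in>UNIV - (V2 + T1). h s = 0))"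
    if "0 \<in> interior W" for W
    using T[unfolded approximable_interpolation_set_def, THEN conjunct2, THEN spec, THEN mp, OF that] .
  obtain V V' where V: "open V" "0 \<in> V" "closure V \<subseteq> V'" "V' \<subseteq> U"
    and hV: "\<And>S. S \<subseteq> T \<Longrightarrow> \<exists>h\<in>A. (\<forall>s\<in>V + S. h s = 1) \<and> (\<forall>s\<in>UNIV - (V' + S). h s = 0)"
    using approx[OF U(1)] by metis
  have "V \<subseteq> V'" using V(3) closure_subset by blast
  have unique: "t = t'" if "v + t = v' + t'" "v \<in> U" "v' \<in> U" "t \<in> T" "t' \<in> T" for v v' t t'
    using U(2) that unfolding right_uniformly_discrete_def by blast
  have "\<exists>p. \<forall>v\<in>V. \<forall>t\<in>T. p (v + t) = t"
  proof (intro exI ballI)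
    fix v t assume "v \<in> V" "t \<in> T"
    then show "(THE t'. t' \<in> T \<and> (\<exists>v'\<in>V. v + t = v' + t')) = t"
      using unique \<open>V \<subseteq> V'\<close> \<open>V' \<subseteq> U\<close> by (intro the_equality) blast+
  qed
  then obtain p where p: "\<And>v t. v \<in> V \<Longrightarrow> t \<in> T \<Longrightarrow> p (v + t) = t"
    by blast
  have "0 \<in> interior V" using V(1,2) by (simp add: interior_open)
  then obtain W W' h where W: "0 \<in> W" "W' \<subseteq> V" and h: "h \<in> A"
    "\<And>s. s \<in> W + T \<Longrightarrow> h s = 1" "\<And>s. s \<notin> W' + T \<Longrightarrow> h s = 0"
    using approx[of V] by (metis DiffI UNIV_I subset_refl)
  obtain u where u: "u \<in> A" "\<And>s. s \<in> W + T \<Longrightarrow> u s = 1" "\<And>s. s \<notin> W' + T \<Longrightarrow> u s = 0"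
    "\<And>s. cmod (u s) \<le> 1"
    using separating_function[OF A h(1), of 0 1 "W + T" "- (W' + T)"] h(2,3) by auto
  have supp: "s \<in> V + T" if "u s \<noteq> 0" for s
    using u(3)[of s] that set_plus_mono2[OF W(2) order_refl[of T]] by blast
  have ind: "\<exists>g\<in>A. (\<forall>s\<in>V + T. g s = of_bool (p s \<in> S)) \<and> (\<forall>s. cmod (g s) \<le> 1)" for S
  proof -
    obtain h where h: "h \<in> A" "\<And>s. s \<in> V + (T \<inter> S) \<Longrightarrow> h s = 1"
      "\<And>s. s \<notin> V' + (T \<inter> S) \<Longrightarrow> h s = 0"
      using hV[of "T \<inter> S"] by blast
    have off: "s \<notin> V' + (T \<inter> S)" if "s \<in> V + (T - S)" for s
      using that unique \<open>V \<subseteq> V'\<close> \<open>V' \<subseteq> U\<close> by (fastforce simp: set_plus_def)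
    obtain g where g: "g \<in> A" "\<And>s. s \<in> V + (T \<inter> S) \<Longrightarrow> g s = 1"
      "\<And>s. s \<in> V + (T - S) \<Longrightarrow> g s = 0" "\<And>s. cmod (g s) \<le> 1"
      using separating_function[OF A h(1), of 0 1 "V + (T \<inter> S)" "V + (T - S)"] h(2,3) off by auto
    have "g s = of_bool (p s \<in> S)" if "s \<in> V + T" for s
      using that
    proof (rule set_plus_elim)
      fix v t assume "s = v + t" "v \<in> V" "t \<in> T"
      then show ?thesis
        using p[of v t] g(2,3)[of s] set_plus_intro[of v V t] by (cases "t \<in> S") auto
    qed
    with g show ?thesis by blast
  qed
  have retract: "p s \<in> T" if "s \<in> V + T" for s
    using that p by (auto elim!: set_plus_elim)
  show thesis
  proof
    show "p t = t" if "t \<in> T" for t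
      using p[OF V(2) that] by simp
    show "u t = 1" if "t \<in> T" for t
      using u(2)[of t] set_plus_intro[OF W(1) that] by simp
    show "cmod (u s) \<le> 1" for s
      by (rule u)
    show "(\<lambda>s. f (p s) * u s) \<in> A" if f: "bounded (f ` T)" for f
    proof -
      have "bounded (f ` p ` (V + T))"
        by (rule bounded_subset[OF f]) (use retract in blast)
      then obtain g where g: "g \<in> A" "\<And>s. s \<in> V + T \<Longrightarrow> g s = f (p s)"
        using bounded_function_lift[OF A ind] by blast
      have "(\<lambda>s. f (p s) * u s) = (\<lambda>s. g s * u s)"
        using g(2) supp by fastforce
      with cstar_mult[OF A g(1) u(1)] show ?thesis by simp
    qed
  qed
qed

section \<open>Norms and cosets\<close>

lemma cmod_le_sup_norm: "bounded (range f) \<Longrightarrow> cmod (f x) \<le> sup_norm f"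
  unfolding sup_norm_def
  by (rule cSUP_upper) (auto simp: bounded_iff bdd_above_def)

lemma sup_norm_le: "(\<And>x. cmod (f x) \<le> N) \<Longrightarrow> sup_norm f \<le> N"
  unfolding sup_norm_def by (rule cSUP_least) auto

lemma linf_bounded: "f \<in> linf K \<Longrightarrow> bounded (range f)"
proof -
  assume f: "f \<in> linf K"
  have "range f \<subseteq> insert 0 (f ` K)"
    using f by (auto simp: linf_def)
  moreover have "bounded (insert 0 (f ` K))"
    using f by (simp add: linf_def)
  ultimately show ?thesis
    using bounded_subset by blast
qed

lemma coset_self:
  assumes "unital_cstar_subalgebra B"
  shows "a \<in> a +o B"
  using set_plus_intro2[OF cstar_const[OF assms, of 0], of a] by (simp add: plus_fun_def)

lemma coset_add:
  assumes "unital_cstar_subalgebra B"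
  shows "(a + b) +o B = (a +o B) + (b +o B)"
proof -
  have "B + B = B"
  proof
    show "B + B \<subseteq> B"
      using cstar_add[OF assms] by (auto simp: set_plus_def plus_fun_def)
    show "B \<subseteq> B + B"
      using set_zero_plus2[of B B] cstar_const[OF assms, of 0] by (simp add: zero_fun_def)
  qed
  then show ?thesis
    by (simp add: set_plus_rearrange)
qed

lemma coset_scale:
  assumes "unital_cstar_subalgebra B"
  shows "cscale c a +o B = quotient_scale B c (a +o B)"
proof
  show "cscale c a +o B \<subseteq> quotient_scale B c (a +o B)"
  proof
    fix x assume "x \<in> cscale c a +o B"
    then obtain b where "b \<in> B" "x = cscale c a + b"
      by (auto simp: elt_set_plus_def)
    moreover have "a \<in> a +o B"
      by (rule coset_self[OF assms])
    ultimately show "x \<in> quotient_scale B c (a +o B)"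
      unfolding quotient_scale_def by blast
  qed
  show "quotient_scale B c (a +o B) \<subseteq> cscale c a +o B"
  proof
    fix x assume "x \<in> quotient_scale B c (a +o B)"
    then obtain b b' where b: "b \<in> B" "b' \<in> B" "x = cscale c (a + b) + b'"
      by (auto simp: quotient_scale_def set_plus_def elt_set_plus_def)
    then have "x = cscale c a + (\<lambda>y. c * b y + b' y)"
      by (auto simp: cscale_def algebra_simps)
    moreover have "(\<lambda>y. c * b y + b' y) \<in> B"
      using b by (intro cstar_add[OF assms] cstar_scale[OF assms])
    ultimately show "x \<in> cscale c a +o B" by blast
  qed
qed

section \<open>The isometry\<close>

theorem theorem2p11:
  fixes A1 A2 :: "('g::{topological_group_add, t2_space} \<Rightarrow> complex) set"
    and \<kappa> :: "'k rel"
    and T :: "'k \<Rightarrow> 'g set"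
    and U :: "'g set"
  assumes "locally_compact_space (euclidean :: 'g topology)"
    and "unital_cstar_subalgebra A1" and "unital_cstar_subalgebra A2"
    and "A1 \<subset> A2" and "A2 \<subseteq> LUC"
    and "admissible A2"
    and "Card_order \<kappa>"
    and "disjoint_family_on T (Field \<kappa>)"
    and "\<And>\<eta>. \<eta> \<in> Field \<kappa> \<Longrightarrow> \<not> interpolation_set A1 (T \<eta>)"
    and "approximable_interpolation_set A2 (\<Union>\<eta>\<in>Field \<kappa>. T \<eta>)"
    and "compact U" and "0 \<in> interior U"
    and "right_uniformly_discrete U (\<Union>\<eta>\<in>Field \<kappa>. T \<eta>)"
  shows "\<exists>\<Psi>. linear_isometry_linf_quotient (Field \<kappa>) A2 A1 \<Psi>"
proof -
  define K where "K = Field \<kappa>"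
  note A1 = assms(2) and A2 = assms(3)
  have "\<exists>S. \<not> (\<exists>g\<in>A1. (\<forall>x\<in>T \<eta>. g x = of_bool (x \<in> S)) \<and> (\<forall>x. cmod (g x) \<le> 1))"
    if "\<eta> \<in> K" for \<eta>
    using inseparable_subset_exists[OF A1 assms(9)] that unfolding K_def by metis
  then obtain S where
    S: "\<And>\<eta>. \<eta> \<in> K \<Longrightarrow>
        \<not> (\<exists>g\<in>A1. (\<forall>x\<in>T \<eta>. g x = of_bool (x \<in> S \<eta>)) \<and> (\<forall>x. cmod (g x) \<le> 1))"
    by metis
  obtain u p where p: "\<And>t. t \<in> (\<Union>\<eta>\<in>K. T \<eta>) \<Longrightarrow> p t = t"
    and u: "\<And>t. t \<in> (\<Union>\<eta>\<in>K. T \<eta>) \<Longrightarrow> u t = 1" "\<And>s. cmod (u s) \<le> 1"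
    and ext: "\<And>f. bounded (f ` (\<Union>\<eta>\<in>K. T \<eta>)) \<Longrightarrow> (\<lambda>s. f (p s) * u s) \<in> A2"
    using bump_extension[OF A2 assms(10,12,13)] unfolding K_def by metis
  define idx where "idx t = (THE \<eta>. \<eta> \<in> K \<and> t \<in> T \<eta>)" for t
  have idx: "idx t = \<eta>" if "\<eta> \<in> K" "t \<in> T \<eta>" for t \<eta>
    unfolding idx_def using that assms(8)
    by (intro the_equality) (auto simp: disjoint_family_on_def K_def)
  define \<sigma> :: "'g \<Rightarrow> complex" where "\<sigma> t = (if t \<in> S (idx t) then 1 else - 1)" for t
  have \<sigma>: "cmod (\<sigma> t) = 1" for t
    by (simp add: \<sigma>_def)
  \<comment> \<open>On \<open>T \<eta>\<close> this is \<open>f \<eta> * \<sigma>\<close>; off the support of the bump the values of \<open>p\<close> and \<open>idx\<close> are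
    arbitrary and are multiplied by \<open>0\<close>.\<close>
  define E where "E f = (\<lambda>s. f (idx (p s)) * \<sigma> (p s) * u s)" for f :: "'k \<Rightarrow> complex"
  have E_in: "E f \<in> A2" if "f \<in> linf K" for f
  proof -
    have "cmod (f (idx t) * \<sigma> t) \<le> sup_norm f" for t
      using cmod_le_sup_norm[OF linf_bounded[OF that]] by (simp add: norm_mult \<sigma>)
    then have "bounded ((\<lambda>t. f (idx t) * \<sigma> t) ` (\<Union>\<eta>\<in>K. T \<eta>))"
      by (force simp: bounded_iff)
    from ext[OF this] show ?thesis
      by (simp add: E_def)
  qed
  have norm: "quotient_norm (E f +o A1) = sup_norm f" if f: "f \<in> linf K" for f
    unfolding quotient_norm_def
  proof (rule antisym)
    have bdd: "bounded (range (E f + g))" if "g \<in> A1" for g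
      using cstar_bounded[OF A2 cstar_add[OF A2 E_in[OF f], of g]] that assms(4)
      by (auto simp: plus_fun_def)
    have lower: "sup_norm f \<le> sup_norm (E f + g)" if g: "g \<in> A1" for g
    proof (rule sup_norm_le)
      fix \<eta>
      show "cmod (f \<eta>) \<le> sup_norm (E f + g)"
      proof (cases "\<eta> \<in> K")
        case True
        have "cmod (f \<eta> * (if t \<in> S \<eta> then 1 else - 1) + g t) \<le> sup_norm (E f + g)"
          if t: "t \<in> T \<eta>" for t
        proof -
          have "E f t = f \<eta> * (if t \<in> S \<eta> then 1 else - 1)"
            using p[OF UN_I, OF True t] u(1)[OF UN_I, OF True t] idx[OF True t]
            by (simp add: E_def \<sigma>_def)
          with cmod_le_sup_norm[OF bdd[OF g], of t] show ?thesis
            by simp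
        qed
        from inseparable_lower_bound[OF A1 S[OF True] g this] show ?thesis .
      next
        case False
        then have "f \<eta> = 0"
          using f by (simp add: linf_def)
        then show ?thesis
          using order_trans[OF norm_ge_zero cmod_le_sup_norm[OF bdd[OF g]]] by simp
      qed
    qed
    have zero: "E f \<in> E f +o A1"
      by (rule coset_self[OF A1])
    show "sup_norm f \<le> (INF h\<in>E f +o A1. sup_norm h)"
      using zero lower by (intro cINF_greatest) (auto simp: elt_set_plus_def)
    have "cmod (E f s) \<le> sup_norm f" for s
    proof -
      have "cmod (f (idx (p s))) * cmod (u s) \<le> sup_norm f * 1"
        using cmod_le_sup_norm[OF linf_bounded[OF f]] u(2) order_trans[OF norm_ge_zero]
        by (intro mult_mono) auto
      then show ?thesis
        by (simp add: E_def norm_mult \<sigma>)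
    qed
    then have "sup_norm (E f) \<le> sup_norm f"
      by (rule sup_norm_le)
    moreover have "bdd_below (sup_norm ` (E f +o A1))"
      using lower by (intro bdd_belowI2[where m = "sup_norm f"]) (auto simp: elt_set_plus_def)
    ultimately show "(INF h\<in>E f +o A1. sup_norm h) \<le> sup_norm f"
      using cINF_lower[OF _ zero] order_trans by blast
  qed
  have "E (f + g) = E f + E g" for f g
    by (auto simp: E_def algebra_simps)
  moreover have "E (cscale c f) = cscale c (E f)" for c f
    by (auto simp: E_def cscale_def algebra_simps)
  ultimately have "linear_isometry_linf_quotient K A2 A1 (\<lambda>f. E f +o A1)"
    unfolding linear_isometry_linf_quotient_def quotient_space_def
    using E_in norm coset_add[OF A1] coset_scale[OF A1] by auto
  then show ?thesis
    unfolding K_def by blast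
qed

end
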